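(* Let (PP) be a polynomial problem, let (LP) be the RLT relaxation with $J$-sets of (PP), and let $(\mathrm{LP}_2)$ be the RLT relaxation with $J$-sets of the quadratic problem obtained from (PP) by applying quadrification Scheme 2. Let $N^{LP}$ and $N^{LP}_2$ be the numbers of variables in (LP) and $(\mathrm{LP}_2)$, respectively. Then $N^{LP}\leq N^{LP}_2$.
   Context: **Polynomial problem.** (PP) is: minimize $\phi_0(x)$ subject to $\phi_r(x)\ge\beta_r$ for $r=1,\dots,R_1$, $\phi_r(x)=\beta_r$ for $r=R_1+1,\dots,R$, and $x\in\Omega=\{x\in\mathbb{R}^n: 0\le l_j\le x_j\le u_j<\infty,\ j\in N\}$, where $N=\{1,\dots,n\}$ and each $\phi_r$ is a polynomial of degree $\delta_r$. Each monomial $\prod_{j\in J}x_j$ is identified with the multiset $J$ of its variable indices (with repetition); $|J|$ is its size counted with repetition. Unions and inclusions of multisets are taken with multiplicity ($J_1\cup J_2$ is the multiset sum). A monomial appears in (PP) if it occurs in some $\phi_r$, $0\le r\le R$. **$J$-sets.** The $J$-sets of a polynomial problem are the multisets of the monomials of degree greater than one appearing in it that are not strictly contained in the multiset of another monomial appearing in it. $\mathbb{J}$ is the set of $J$-sets of (PP). **RLT relaxation with $J$-sets.** Given a polynomial problem in variables $y_i$ with bounds $l_i\le y_i\le u_i$, its RLT relaxation with $J$-sets is obtained as follows. For each $J$-set $J$ and all multisets $J_1,J_2$ with $J_1\cup J_2=J$, add the bound-factor constraint $\prod_{i\in J_1}(y_i-l_i)\prod_{i\in J_2}(u_i-y_i)\ge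 0$. Then linearize everything (operator $[\cdot]_L$): replace each monomial of degree greater than one, with multiset $I$, by a new RLT variable $X^{RLT}_I$. (LP) is this relaxation applied directly to (PP). **Scheme 2.** $X^Q_J$ denotes a new variable representing $\prod_{j\in J}x_j$, with $X^Q_{\{j\}}=x_j$; its bounds are the products of the corresponding bounds of the $x_j$. Every monomial of degree greater than 2 in $\phi_0,\dots,\phi_R$ is replaced by $X^Q_J$. Moreover, for each $J\in\mathbb{J}$ with $|J|>2$ and each $J'\subseteq J$ with $|J'|\ge2$, the quadratic constraints $X^Q_{J'}=X^Q_{J_1}X^Q_{J_2}$ are added for each unordered pair of nonempty multisets $J_1,J_2$ with $J_1\cup J_2=J'$. The result is a quadratic problem in the variables $x_j$ and $X^Q_J$. $(\mathrm{LP}_2)$ is the RLT relaxation with $J$-sets of this quadratic problem; its $J$-sets are all size-two multisets of variables (of the quadratic problem) whose product occurs in that problem. **Counting.** The number of variables counts the $x_j$, the $X^Q$ variables (if any) and the RLT variables. An $X^Q$ variable and an RLT variable are regarded as distinct even if they represent the same product of the $x_j$. An RLT variable is counted for every submultiset of size at least two of a $J$-set (bounds being treated symbolically when expanding bound factors). Identical variables arising several times are counted once. *)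

theory Defs
  imports Complex_Main "HOL-Library.Multiset" "HOL-Library.Poly_Mapping"
begin

text \<open>
  A multiset of variables is a monomial, the empty multiset being the monomial 1, and multiset sum
  is multiplication of monomials. Finitely supported functions from multisets to the reals are
  therefore exactly the real polynomials, and the convolution product that
  \<^theory>\<open>HOL-Library.Poly_Mapping\<close> puts on them is the product of polynomials.
\<close>

type_synonym 'v mpoly = "'v multiset \<Rightarrow>\<^sub>0 real"

definition mvar :: "'v \<Rightarrow> 'v mpoly" where
  "mvar i = Poly_Mapping.single {#i#} 1"

definition mconst :: "real \<Rightarrow> 'v mpoly" where
  "mconst c = Poly_Mapping.single {#} c"

definition map_monomials :: "('v multiset \<Rightarrow> 'w multiset) \<Rightarrow> 'v mpoly \<Rightarrow> 'w mpoly" where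
  "map_monomials f p =
     (\<Sum>m\<in>Poly_Mapping.keys p. Poly_Mapping.single (f m) (Poly_Mapping.lookup p m))"

text \<open>
  An element \<open>(p, b)\<close> of \<open>geqs\<close> stands for the constraint \<open>p \<ge> b\<close>, one of \<open>eqs\<close> for \<open>p = b\<close>. The
  objective is minimized.
\<close>

record 'v problem =
  vars :: "'v set"
  objective :: "'v mpoly"
  geqs :: "('v mpoly \<times> real) set"
  eqs :: "('v mpoly \<times> real) set"

record 'v bounded_problem = "'v problem" +
  lower :: "'v \<Rightarrow> real"
  upper :: "'v \<Rightarrow> real"

definition polynomial_problem ::
    "nat \<Rightarrow> nat \<Rightarrow> nat \<Rightarrow> (nat \<Rightarrow> nat mpoly) \<Rightarrow> (nat \<Rightarrow> real) \<Rightarrow> (nat \<Rightarrow> real) \<Rightarrow> (nat \<Rightarrow> real)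
      \<Rightarrow> nat bounded_problem" where
  "polynomial_problem n R\<^sub>1 R \<phi> \<beta> l u =
     \<lparr>vars = {1..n},
      objective = \<phi> 0,
      geqs = (\<lambda>r. (\<phi> r, \<beta> r)) ` {1..R\<^sub>1},
      eqs = (\<lambda>r. (\<phi> r, \<beta> r)) ` {R\<^sub>1+1..R},
      lower = l, upper = u\<rparr>"

definition monomials :: "('v, 'z) problem_scheme \<Rightarrow> 'v multiset set" where
  "monomials P = Poly_Mapping.keys (objective P) \<union>
     (\<Union>(p, b)\<in>geqs P \<union> eqs P. Poly_Mapping.keys p)"

definition J_sets :: "('v, 'z) problem_scheme \<Rightarrow> 'v multiset set" where
  "J_sets P = {J \<in> monomials P. size J > 1 \<and> \<not> (\<exists>J'\<in>monomials P. J \<subset># J')}"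


subsection \<open>RLT relaxation with J-sets\<close>

datatype 'v rlt_var = Y 'v | XRLT "'v multiset"

definition linearize_monomial :: "'v multiset \<Rightarrow> 'v rlt_var multiset" where
  "linearize_monomial I = (if size I > 1 then {#XRLT I#} else image_mset Y I)"

definition linearize :: "'v mpoly \<Rightarrow> 'v rlt_var mpoly" where
  "linearize = map_monomials linearize_monomial"

definition bound_factor :: "'v bounded_problem \<Rightarrow> 'v multiset \<Rightarrow> 'v multiset \<Rightarrow> 'v mpoly" where
  "bound_factor P J\<^sub>1 J\<^sub>2 =
     (\<Prod>i\<in>#J\<^sub>1. mvar i - mconst (lower P i)) * (\<Prod>i\<in>#J\<^sub>2. mconst (upper P i) - mvar i)"

text \<open>
  The RLT variables are those of all submultisets of size at least two of a J-set, i.e. those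
  obtained when the bound factors are expanded with symbolic bounds. For particular values of the
  bounds (for instance 0) some of them may have coefficient 0 in every constraint; they are
  variables of the relaxation nevertheless. The bounds on the original variables, which are already
  linear, become ordinary constraints of the linear program.
\<close>

definition RLT :: "'v bounded_problem \<Rightarrow> 'v rlt_var problem" where
  "RLT P =
     \<lparr>vars = Y ` vars P \<union> XRLT ` {I. size I \<ge> 2 \<and> (\<exists>J\<in>J_sets P. I \<subseteq># J)},
      objective = linearize (objective P),
      geqs = (\<lambda>(p, b). (linearize p, b)) ` geqs P
        \<union> {(linearize (bound_factor P J\<^sub>1 J\<^sub>2), 0) | J\<^sub>1 J\<^sub>2. J\<^sub>1 + J\<^sub>2 \<in> J_sets P}
        \<union> {(mvar (Y i), lower P i) | i. i \<in> vars P}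
        \<union> {(- mvar (Y i), - upper P i) | i. i \<in> vars P},
      eqs = (\<lambda>(p, b). (linearize p, b)) ` eqs P\<rparr>"


subsection \<open>Quadrification Scheme 2\<close>

datatype 'v quad_var = X 'v | XQ "'v multiset"

definition xq :: "'v multiset \<Rightarrow> 'v quad_var" where
  "xq J = (if size J = 1 then X (the_elem (set_mset J)) else XQ J)"

definition quad_monomial :: "'v multiset \<Rightarrow> 'v quad_var multiset" where
  "quad_monomial I = (if size I > 2 then {#xq I#} else image_mset X I)"

definition quadrify :: "'v mpoly \<Rightarrow> 'v quad_var mpoly" where
  "quadrify = map_monomials quad_monomial"

fun quad_bound :: "('v \<Rightarrow> real) \<Rightarrow> 'v quad_var \<Rightarrow> real" where
  "quad_bound b (X j) = b j"
| "quad_bound b (XQ J) = (\<Prod>j\<in>#J. b j)"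

definition scheme2_multisets :: "'v bounded_problem \<Rightarrow> 'v multiset set" where
  "scheme2_multisets P = {J'. size J' \<ge> 2 \<and> (\<exists>J\<in>J_sets P. size J > 2 \<and> J' \<subseteq># J)}"

text \<open>
  Every monomial of degree greater than two lies in \<open>scheme2_multisets P\<close> whenever \<open>monomials P\<close> is
  finite, so the variables introduced by \<open>quadrify\<close> are all among those listed in \<open>vars\<close>. As the
  product is commutative and the constraints form a set, the two orderings of a pair
  \<open>J\<^sub>1, J\<^sub>2\<close> contribute one and the same constraint.
\<close>

definition scheme2 :: "'v bounded_problem \<Rightarrow> 'v quad_var bounded_problem" where
  "scheme2 P =
     \<lparr>vars = X ` vars P \<union> xq ` scheme2_multisets P,
      objective = quadrify (objective P),
      geqs = (\<lambda>(p, b). (quadrify p, b)) ` geqs P,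
      eqs = (\<lambda>(p, b). (quadrify p, b)) ` eqs P
        \<union> {(mvar (xq (J\<^sub>1 + J\<^sub>2)) - mvar (xq J\<^sub>1) * mvar (xq J\<^sub>2), 0) | J\<^sub>1 J\<^sub>2.
             J\<^sub>1 \<noteq> {#} \<and> J\<^sub>2 \<noteq> {#} \<and> J\<^sub>1 + J\<^sub>2 \<in> scheme2_multisets P},
      lower = quad_bound (lower P), upper = quad_bound (upper P)\<rparr>"

end

theory Submission
  imports Defs
begin

text \<open>
  Every variable of the relaxation of the original problem has a counterpart of its own in the
  relaxation of the quadratic problem. An original variable \<open>x\<^sub>j\<close> is its own counterpart. Let
  \<open>I\<close> be the multiset of an RLT variable, so that \<open>I\<close> has size at least two and is contained
  in some J-set \<open>J\<close>.

  If \<open>J\<close> can be chosen with more than two elements, Scheme 2 creates the variable \<open>XQ I\<close> while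
  splitting \<open>J\<close>. It serves as the counterpart already as a variable of the quadratic
  problem, before that problem is relaxed. Otherwise \<open>I = J\<close> is a quadratic monomial, which Scheme 2
  leaves as a product of two original variables. Since all monomials of the quadratic problem have
  degree at most two, this product is a J-set there (\<open>quadratic_monomial_J_set_scheme2\<close>), and its
  RLT variable is the counterpart. The map defined in this way is injective (\<open>inj_lift_rlt_var\<close>)
  and lands in the variables of the relaxation of the quadratic problem (\<open>lift_rlt_var_vars\<close>),
  which are finite in number, so that cardinalities can be compared.

  In the second case the quadratic monomial must really occur in the quadratic problem. Two
  monomials of one polynomial could only cancel if the substitution identified them, and
  \<open>inj_quad_monomial\<close> excludes this.
\<close>


section \<open>Polynomials under a renaming of monomials\<close>

lemma keys_map_monomials_subset:
  "Poly_Mapping.keys (map_monomials f p) \<subseteq> f ` Poly_Mapping.keys p"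
proof -
  have "Poly_Mapping.keys (map_monomials f p)
      \<subseteq> (\<Union>m\<in>Poly_Mapping.keys p.
           Poly_Mapping.keys (Poly_Mapping.single (f m) (Poly_Mapping.lookup p m)))"
    unfolding map_monomials_def by (rule keys_sum)
  then show ?thesis
    by (auto split: if_splits)
qed

lemma lookup_map_monomials:
  assumes "inj f"
  shows "Poly_Mapping.lookup (map_monomials f p) (f m) = Poly_Mapping.lookup p m"
proof -
  have "Poly_Mapping.lookup (map_monomials f p) (f m)
      = (\<Sum>k\<in>Poly_Mapping.keys p. if k = m then Poly_Mapping.lookup p k else 0)"
    unfolding map_monomials_def lookup_sum
    by (rule sum.cong) (auto simp: lookup_single when_def inj_eq[OF assms])
  then show ?thesis
    by (simp add: in_keys_iff)
qed

text \<open>Distinct monomials stay distinct, so no coefficients can cancel.\<close>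

lemma keys_map_monomials:
  assumes "inj f"
  shows "Poly_Mapping.keys (map_monomials f p) = f ` Poly_Mapping.keys p"
  using keys_map_monomials_subset[of f p]
  by (auto simp: in_keys_iff lookup_map_monomials[OF assms])

lemma inj_quad_monomial: "inj quad_monomial"
proof (rule injI)
  fix I J :: "'v multiset"
  assume eq: "quad_monomial I = quad_monomial J"
  have inj_X: "inj (image_mset (X :: 'v \<Rightarrow> 'v quad_var))"
    by (rule multiset.inj_map) (simp add: inj_on_def)
  (* A product of original variables X j involves no XQ, so a large monomial can be read off. *)
  have XQ_iff: "XQ L \<in># quad_monomial K \<longleftrightarrow> size K > 2 \<and> L = K" for K L :: "'v multiset"
    by (auto simp: quad_monomial_def xq_def)
  show "I = J"
  proof (cases "size I > 2")
    case True
    then show ?thesis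
      using XQ_iff[of I I] XQ_iff[of I J] eq by simp
  next
    case False
    then have "\<not> size J > 2"
      using XQ_iff[of J I] XQ_iff[of J J] eq by simp
    with False show ?thesis
      using eq injD[OF inj_X, of I J] by (simp add: quad_monomial_def)
  qed
qed


section \<open>The quadratic problem has degree at most two\<close>

lemma monomials_scheme2_size_le_2:
  assumes "K \<in> monomials (scheme2 P)"
  shows "size K \<le> 2"
proof -
  have quad: "size K \<le> 2" if "K \<in> Poly_Mapping.keys (quadrify p)" for p
    using that by (auto simp: quadrify_def keys_map_monomials[OF inj_quad_monomial] quad_monomial_def)
  have defining: "size K \<le> 2"
    if "K \<in> Poly_Mapping.keys (mvar a - mvar b * mvar c)" for a b c :: "'a quad_var"
  proof -
    have "K \<in> Poly_Mapping.keys (mvar a) \<union> Poly_Mapping.keys (mvar b * mvar c)"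
      using that by (rule subsetD[OF keys_diff])
    then show ?thesis
    proof
      assume "K \<in> Poly_Mapping.keys (mvar b * mvar c)"
      then show ?thesis
        using subsetD[OF keys_mult] by (fastforce simp: mvar_def)
    qed (simp add: mvar_def)
  qed
  show ?thesis
    using assms by (auto simp: monomials_def scheme2_def intro: quad defining)
qed

lemma quad_monomial_in_scheme2:
  assumes "m \<in> monomials P"
  shows "quad_monomial m \<in> monomials (scheme2 P)"
proof -
  have mem: "quad_monomial m \<in> Poly_Mapping.keys (quadrify p)" if "m \<in> Poly_Mapping.keys p" for p
    using that by (simp add: quadrify_def keys_map_monomials[OF inj_quad_monomial])
  from assms consider "m \<in> Poly_Mapping.keys (objective P)"
    | p b where "(p, b) \<in> geqs P \<union> eqs P" "m \<in> Poly_Mapping.keys p"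
    unfolding monomials_def by blast
  then show ?thesis
  proof cases
    case 1
    then show ?thesis
      by (simp add: monomials_def scheme2_def mem)
  next
    case 2
    then have "(quadrify p, b) \<in> geqs (scheme2 P) \<union> eqs (scheme2 P)"
      by (auto simp: scheme2_def intro: rev_image_eqI)
    with mem[OF 2(2)] show ?thesis
      unfolding monomials_def by blast
  qed
qed

text \<open>Nothing of degree three or more is left that could contain a product of two variables
  strictly, so every quadratic monomial of the problem survives as a J-set.\<close>

lemma quadratic_monomial_J_set_scheme2:
  assumes "I \<in> monomials P" and "size I = 2"
  shows "image_mset X I \<in> J_sets (scheme2 P)"
proof -
  have "image_mset X I \<in> monomials (scheme2 P)"
    using quad_monomial_in_scheme2[OF assms(1)] assms(2) by (simp add: quad_monomial_def)
  moreover have "\<not> image_mset X I \<subset># K" if "K \<in> monomials (scheme2 P)" for K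
    using monomials_scheme2_size_le_2[OF that] assms(2) by (auto dest: mset_subset_size)
  ultimately show ?thesis
    using assms(2) unfolding J_sets_def by simp
qed


section \<open>Finiteness\<close>

lemma finite_submultisets:
  assumes "finite A"
  shows "finite {I. \<exists>J\<in>A. I \<subseteq># J}"
proof -
  have "{I. I \<subseteq># J} \<subseteq> mset ` {xs. set xs \<subseteq> set_mset J \<and> length xs \<le> size J}" for J :: "'a multiset"
  proof
    fix I assume "I \<in> {I. I \<subseteq># J}"
    moreover obtain xs where "mset xs = I"
      using ex_mset by blast
    ultimately show "I \<in> mset ` {xs. set xs \<subseteq> set_mset J \<and> length xs \<le> size J}"
      using set_mset_mono size_mset_mono by fastforce
  qed
  then have "finite {I. I \<subseteq># J}" for J :: "'a multiset"
    by (rule finite_subset) (simp add: finite_lists_length_le)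
  moreover have "{I. \<exists>J\<in>A. I \<subseteq># J} = (\<Union>J\<in>A. {I. I \<subseteq># J})"
    by blast
  ultimately show ?thesis
    using assms by simp
qed

lemma finite_J_sets:
  assumes "finite (geqs P)" and "finite (eqs P)"
  shows "finite (J_sets P)"
proof (rule finite_subset)
  show "J_sets P \<subseteq> monomials P"
    by (auto simp: J_sets_def)
  show "finite (monomials P)"
    using assms by (auto simp: monomials_def)
qed

text \<open>Infinite sets have cardinality 0, so comparing cardinalities along an injection requires its
  target to be finite. As the target is the relaxation of the quadratic problem, both
  constructions have to preserve finiteness.\<close>

lemma finite_vars_RLT:
  assumes "finite (vars P)" and "finite (geqs P)" and "finite (eqs P)"
  shows "finite (vars (RLT P))"
  using assms(1) finite_submultisets[OF finite_J_sets[OF assms(2,3)]] by (simp add: RLT_def)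

lemma finite_scheme2_multisets:
  assumes "finite (geqs P)" and "finite (eqs P)"
  shows "finite (scheme2_multisets P)"
  by (rule finite_subset[OF _ finite_submultisets[OF finite_J_sets[OF assms]]])
    (auto simp: scheme2_multisets_def)

lemma finite_scheme2:
  assumes "finite (vars P)" and "finite (geqs P)" and "finite (eqs P)"
  shows "finite (vars (scheme2 P))" "finite (geqs (scheme2 P))" "finite (eqs (scheme2 P))"
proof -
  let ?S = "scheme2_multisets P"
  let ?D = "{I. \<exists>J\<in>?S. I \<subseteq># J}"
  let ?c = "\<lambda>(J\<^sub>1, J\<^sub>2). (mvar (xq (J\<^sub>1 + J\<^sub>2)) - mvar (xq J\<^sub>1) * mvar (xq J\<^sub>2), 0 :: real)"
  have S: "finite ?S"
    using assms(2,3) by (rule finite_scheme2_multisets)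
  then have D: "finite (?c ` (?D \<times> ?D))"
    by (intro finite_imageI finite_cartesian_product finite_submultisets)
  have "{(mvar (xq (J\<^sub>1 + J\<^sub>2)) - mvar (xq J\<^sub>1) * mvar (xq J\<^sub>2), 0 :: real) | J\<^sub>1 J\<^sub>2.
      J\<^sub>1 \<noteq> {#} \<and> J\<^sub>2 \<noteq> {#} \<and> J\<^sub>1 + J\<^sub>2 \<in> ?S} \<subseteq> ?c ` (?D \<times> ?D)"
  proof clarify
    fix J\<^sub>1 J\<^sub>2
    assume "J\<^sub>1 + J\<^sub>2 \<in> ?S"
    then have "(J\<^sub>1, J\<^sub>2) \<in> ?D \<times> ?D"
      using mset_subset_eq_add_left mset_subset_eq_add_right by blast
    then show "(mvar (xq (J\<^sub>1 + J\<^sub>2)) - mvar (xq J\<^sub>1) * mvar (xq J\<^sub>2), 0) \<in> ?c ` (?D \<times> ?D)"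
      by (rule rev_image_eqI) simp
  qed
  from finite_subset[OF this D] S assms
  show "finite (vars (scheme2 P))" "finite (geqs (scheme2 P))" "finite (eqs (scheme2 P))"
    by (simp_all add: scheme2_def)
qed


section \<open>Comparing the numbers of variables\<close>

text \<open>The second clause prefers \<open>XQ I\<close> wherever Scheme 2 creates it, since the RLT variable of
  \<open>image_mset X I\<close> exists only for quadratic \<open>I\<close>.\<close>

fun lift_rlt_var :: "'v bounded_problem \<Rightarrow> 'v rlt_var \<Rightarrow> 'v quad_var rlt_var" where
  "lift_rlt_var P (Y i) = Y (X i)"
| "lift_rlt_var P (XRLT I) =
     (if I \<in> scheme2_multisets P then Y (XQ I) else XRLT (image_mset X I))"

lemma inj_lift_rlt_var: "inj (lift_rlt_var P)"
proof (rule injI)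
  fix v w
  assume eq: "lift_rlt_var P v = lift_rlt_var P w"
  have "inj (image_mset (X :: 'a \<Rightarrow> 'a quad_var))"
    by (rule multiset.inj_map) (simp add: inj_on_def)
  then show "v = w"
    using eq by (cases v; cases w) (auto dest: injD split: if_splits)
qed

lemma lift_rlt_var_vars:
  assumes "v \<in> vars (RLT P)"
  shows "lift_rlt_var P v \<in> vars (RLT (scheme2 P))"
proof (cases v)
  case (Y i)
  with assms show ?thesis
    by (auto simp: RLT_def scheme2_def)
next
  case (XRLT I)
  with assms obtain J where J: "J \<in> J_sets P" "I \<subseteq># J" "size I \<ge> 2"
    by (auto simp: RLT_def)
  show ?thesis
  proof (cases "I \<in> scheme2_multisets P")
    case True
    then have "XQ I \<in> vars (scheme2 P)"
      using J(3) by (force simp: scheme2_def xq_def)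
    with True XRLT show ?thesis
      by (simp add: RLT_def)
  next
    case False
    (* J is too small for Scheme 2 to split it, which leaves no room for I to be smaller. *)
    then have "size J \<le> 2"
      using J by (force simp: scheme2_multisets_def)
    then have "I = J" "size I = 2"
      using J(2,3) mset_subset_size[of I J] size_mset_mono[of I J]
      by (auto simp: subset_mset.le_less)
    with J(1) have "image_mset X I \<in> J_sets (scheme2 P)"
      by (intro quadratic_monomial_J_set_scheme2) (auto simp: J_sets_def)
    with False XRLT \<open>size I = 2\<close> show ?thesis
      by (auto simp: RLT_def)
  qed
qed

theorem card_vars_RLT_le_scheme2:
  assumes "finite (vars P)" and "finite (geqs P)" and "finite (eqs P)"
  shows "card (vars (RLT P)) \<le> card (vars (RLT (scheme2 P)))"
proof (rule card_inj_on_le)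
  show "inj_on (lift_rlt_var P) (vars (RLT P))"
    using inj_lift_rlt_var by (rule inj_on_subset) simp
  show "lift_rlt_var P ` vars (RLT P) \<subseteq> vars (RLT (scheme2 P))"
    using lift_rlt_var_vars by blast
  show "finite (vars (RLT (scheme2 P)))"
    using finite_scheme2[OF assms] by (rule finite_vars_RLT)
qed

theorem theorem2:
  fixes n R\<^sub>1 R :: nat
    and \<phi> :: "nat \<Rightarrow> nat mpoly"
    and \<beta> l u :: "nat \<Rightarrow> real"
  assumes "R\<^sub>1 \<le> R"
    and "\<And>r m. r \<le> R \<Longrightarrow> m \<in> Poly_Mapping.keys (\<phi> r) \<Longrightarrow> set_mset m \<subseteq> {1..n}"
    and "\<And>j. j \<in> {1..n} \<Longrightarrow> 0 \<le> l j \<and> l j \<le> u j"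
  shows "card (vars (RLT (polynomial_problem n R\<^sub>1 R \<phi> \<beta> l u)))
       \<le> card (vars (RLT (scheme2 (polynomial_problem n R\<^sub>1 R \<phi> \<beta> l u))))"
  by (rule card_vars_RLT_le_scheme2) (simp_all add: polynomial_problem_def)

end
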